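(* For every integer $n\geq 5$, the full automorphism group of the pancake graph $P_n$ is $\mathrm{Aut}(P_n)=L(S_n)$, where $L(S_n)$ is the left regular representation of $S_n$.
   Context: For $n\ge 2$ and $2\leq j\leq n$, let $r_{1j}\in S_n$ be the prefix reversal, i.e. the permutation of $\{1,\dots,n\}$ with $r_{1j}(k)=j+1-k$ for $1\leq k\leq j$ and $r_{1j}(k)=k$ for $j<k\leq n$. Let $PR_n=\{r_{1j}: 2\leq j\leq n\}$. The pancake graph $P_n$ is the Cayley graph $\mathrm{Cay}(S_n,PR_n)$: the simple undirected graph with vertex set the symmetric group $S_n$ and edges $\{g,gs\}$ for $g\in S_n$, $s\in PR_n$, where products of permutations are composed as $(gs)(k)=g(s(k))$. $\mathrm{Aut}(P_n)$ denotes the group of all graph automorphisms of $P_n$, viewed as permutations of the vertex set $S_n$. $L(S_n)=\{L(y): y\in S_n\}$, where $L(y):S_n\to S_n$ is left multiplication $x\mapsto yx$. *)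

theory Defs
  imports "HOL-Algebra.Sym_Groups" "HOL-Algebra.Bij" "Graph_Theory.Pair_Digraph"
begin

text \<open>
  Graphs are symmetric loop-free digraphs without parallel arcs, i.e. instances of
  \<^locale>\<open>pair_graph\<close>: an undirected edge \<open>{u, v}\<close> is the pair of arcs \<open>(u, v)\<close>, \<open>(v, u)\<close>.
\<close>

definition cayley_graph :: "('a, 'b) monoid_scheme \<Rightarrow> 'a set \<Rightarrow> 'a pair_pre_digraph" where
  "cayley_graph G S =
     \<lparr> pverts = carrier G,
       parcs = (\<Union>g\<in>carrier G. \<Union>s\<in>S. {(g, g \<otimes>\<^bsub>G\<^esub> s), (g \<otimes>\<^bsub>G\<^esub> s, g)}) \<rparr>"

text \<open>
  As in \<^theory>\<open>HOL-Algebra.Bij\<close>, permutations of the vertex set are extensional functions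
  (\<^term>\<open>undefined\<close> off the vertex set), so that distinct functions are distinct permutations.
\<close>

definition graph_aut :: "'a pair_pre_digraph \<Rightarrow> ('a \<Rightarrow> 'a) set" where
  "graph_aut G =
     {f \<in> Bij (pverts G).
        \<forall>u\<in>pverts G. \<forall>v\<in>pverts G. (f u, f v) \<in> parcs G \<longleftrightarrow> (u, v) \<in> parcs G}"

definition left_mult :: "('a, 'b) monoid_scheme \<Rightarrow> 'a \<Rightarrow> 'a \<Rightarrow> 'a" where
  "left_mult G y = (\<lambda>x\<in>carrier G. y \<otimes>\<^bsub>G\<^esub> x)"

definition left_regular :: "('a, 'b) monoid_scheme \<Rightarrow> ('a \<Rightarrow> 'a) set" where
  "left_regular G = left_mult G ` carrier G"

text \<open>
  The prefix reversal \<open>r\<^sub>1\<^sub>j\<close>. Elements of \<^term>\<open>sym_group n\<close> are functions on all of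
  \<^typ>\<open>nat\<close> that fix every point outside \<open>{1..n}\<close>, so \<open>r\<^sub>1\<^sub>j\<close> is the same function for all
  \<open>n \<ge> j\<close>.
\<close>

definition prefix_reversal :: "nat \<Rightarrow> nat \<Rightarrow> nat" where
  "prefix_reversal j k = (if 1 \<le> k \<and> k \<le> j then j + 1 - k else k)"

definition prefix_reversals :: "nat \<Rightarrow> (nat \<Rightarrow> nat) set" where
  "prefix_reversals n = prefix_reversal ` {2..n}"

definition pancake_graph :: "nat \<Rightarrow> (nat \<Rightarrow> nat) pair_pre_digraph" where
  "pancake_graph n = cayley_graph (sym_group n) (prefix_reversals n)"

lemma graph_aut_subgroup: "subgroup (graph_aut G) (BijGroup (pverts G))"
proof (rule group.subgroupI[OF group_BijGroup])
  show "graph_aut G \<subseteq> carrier (BijGroup (pverts G))"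
    by (auto simp: graph_aut_def BijGroup_def)
  have "(\<lambda>x\<in>pverts G. x) \<in> graph_aut G"
    by (simp add: graph_aut_def id_Bij)
  then show "graph_aut G \<noteq> {}" by blast
next
  fix f assume f: "f \<in> graph_aut G"
  then have B: "f \<in> Bij (pverts G)" by (simp add: graph_aut_def)
  let ?h = "inv_into (pverts G) f"
  have 1: "f (?h u) = u" "?h u \<in> pverts G" if "u \<in> pverts G" for u
    using B that by (auto simp: Bij_def bij_betw_def f_inv_into_f inv_into_into)
  have "(?h u, ?h v) \<in> parcs G \<longleftrightarrow> (u, v) \<in> parcs G"
    if "u \<in> pverts G" "v \<in> pverts G" for u v
    using f 1[OF that(1)] 1[OF that(2)] unfolding graph_aut_def by force
  then show "inv\<^bsub>BijGroup (pverts G)\<^esub> f \<in> graph_aut G"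
    using restrict_inv_into_Bij[OF B] by (simp add: inv_BijGroup[OF B] graph_aut_def)
next
  fix f g assume fg: "f \<in> graph_aut G" "g \<in> graph_aut G"
  then have B: "f \<in> Bij (pverts G)" "g \<in> Bij (pverts G)" by (simp_all add: graph_aut_def)
  then have "g u \<in> pverts G" if "u \<in> pverts G" for u
    using that Bij_imp_funcset by fast
  then have "compose (pverts G) f g \<in> graph_aut G"
    using fg compose_Bij[OF B] by (simp add: graph_aut_def compose_eq)
  then show "f \<otimes>\<^bsub>BijGroup (pverts G)\<^esub> g \<in> graph_aut G"
    using B by (simp add: BijGroup_def)
qed

lemma prefix_reversal_invol: "prefix_reversal j \<circ> prefix_reversal j = id"
  by (auto simp: prefix_reversal_def fun_eq_iff)

lemma prefix_reversal_in_sym_group: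
  assumes "j \<le> n" shows "prefix_reversal j \<in> carrier (sym_group n)"
proof -
  have "prefix_reversal j (prefix_reversal j k) = k" for k
    using prefix_reversal_invol[of j] by (simp add: fun_eq_iff)
  then have "bij_betw (prefix_reversal j) {1..n} {1..n}"
    using assms by (intro bij_betw_byWitness[where f' = "prefix_reversal j"])
      (auto simp: prefix_reversal_def)
  then show ?thesis
    unfolding sym_group_carrier using assms
    by (intro bij_imp_permutes) (auto simp: prefix_reversal_def)
qed

lemma pair_graph_pancake: "pair_graph (pancake_graph n)"
proof
  note defs = pancake_graph_def cayley_graph_def
  have closed: "g \<otimes>\<^bsub>sym_group n\<^esub> s \<in> carrier (sym_group n)"
    if "g \<in> carrier (sym_group n)" "s \<in> prefix_reversals n" for g s
    using that prefix_reversal_in_sym_group group.is_monoid[OF sym_group_is_group]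
    by (auto simp: prefix_reversals_def intro!: monoid.m_closed)
  show "finite (pverts (pancake_graph n))"
    by (simp add: defs sym_group_def finite_permutations)
  then show "finite (parcs (pancake_graph n))"
    by (simp add: defs prefix_reversals_def)
  show "fst e \<in> pverts (pancake_graph n)" "snd e \<in> pverts (pancake_graph n)"
    if "e \<in> parcs (pancake_graph n)" for e
    using that closed by (auto simp: defs)
  show "fst e \<noteq> snd e" if e: "e \<in> parcs (pancake_graph n)" for e
  proof
    assume "fst e = snd e"
    moreover obtain g j where "g \<in> carrier (sym_group n)" "2 \<le> j"
      "e = (g, g \<circ> prefix_reversal j) \<or> e = (g \<circ> prefix_reversal j, g)"
      using e by (auto simp: defs prefix_reversals_def sym_group_mult)
    ultimately have g: "g permutes {1..n}" "2 \<le> j" "g \<circ> prefix_reversal j = g"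
      by (auto simp: sym_group_carrier)
    then have "g (prefix_reversal j 1) = g 1"
      by (metis comp_apply)
    then have "prefix_reversal j 1 = 1"
      using permutes_inj[OF g(1)] by (metis injD)
    then show False
      using \<open>2 \<le> j\<close> by (simp add: prefix_reversal_def)
  qed
  show "symmetric (with_proj (pancake_graph n))"
    unfolding symmetric_def with_proj_simps by (rule symI) (auto simp: defs)
qed

end

theory Submission
  imports Defs
begin

text \<open>
  An automorphism \<open>f\<close> sends the edge from \<open>g\<close> with label \<open>j\<close> (right multiplication by \<open>r\<^sub>1\<^sub>j\<close>) to an
  edge from \<open>f g\<close> with some label \<open>label g j\<close>; once all labels are preserved, \<open>f g \<circ> g\<^sup>-\<^sup>1\<close> is
  constant because prefix reversals generate the symmetric group. Closed walks carry the
  label information. Every 6-cycle alternates the labels 2 and 3, so \<open>{2, 3}\<close> is preserved.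
  If the set of labels below \<open>k\<close> is preserved, the 7-cycle \<open>k, k-1, k, k-1, k-2, k, 2\<close> is sent to
  a closed walk \<open>x, a, y, c, d, z, b\<close> with \<open>a, b, c, d < k \<le> x, y, z\<close>, and this forces \<open>x = k\<close>;
  hence every label from 4 on is preserved. Finally \<open>5, 4, 5, 4, s, 5, t\<close> with
  \<open>s, t \<in> {2, 3}\<close> is closed only if \<open>t = 2\<close>, which separates 2 from 3 and is where \<open>n \<ge> 5\<close> enters.

  The cycle classification looks at the largest label \<open>m\<close> of a closed walk: only \<open>r\<^sub>1\<^sub>m\<close> moves the
  point \<open>m\<close>, and the labels strictly between two occurrences of \<open>m\<close> compose to a permutation
  that, if there are at most two of them, does not fix the point 1. So \<open>m\<close> occurs at least
  three times in a closed walk without backtracking of length at most 7.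
\<close>

section \<open>Prefix reversals on points, and words of reversals\<close>

abbreviation (input) r :: "nat \<Rightarrow> nat \<Rightarrow> nat" where "r \<equiv> prefix_reversal"

declare One_nat_def [simp del]

lemma prefix_reversal_inside: "1 \<le> p \<Longrightarrow> p \<le> j \<Longrightarrow> r j p = j + 1 - p"
  and prefix_reversal_outside: "j < p \<Longrightarrow> r j p = p"
  by (simp_all add: prefix_reversal_def)

lemma prefix_reversal_cancel [simp]: "r j (r j p) = p"
  using prefix_reversal_invol[of j] by (simp add: fun_eq_iff)

lemma prefix_reversal_less: "p < m \<Longrightarrow> j < m \<Longrightarrow> r j p < m"
  by (auto simp: prefix_reversal_def)

lemma prefix_reversal_at_1: "1 \<le> j \<Longrightarrow> r j 1 = j"
  and prefix_reversal_at_end: "1 \<le> j \<Longrightarrow> r j j = 1"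
  by (simp_all add: prefix_reversal_def)

lemma prefix_reversal_eq_1_iff: "1 \<le> j \<Longrightarrow> r j p = 1 \<longleftrightarrow> p = j"
  by (auto simp: prefix_reversal_def)

lemma prefix_reversal_eq_end_iff: "1 \<le> j \<Longrightarrow> r j p = j \<longleftrightarrow> p = 1"
  by (auto simp: prefix_reversal_def)

lemma prefix_reversal_1: "r 1 = id"
  by (auto simp: prefix_reversal_def fun_eq_iff)

text \<open>Edges are right multiplications, so the walk from \<open>g\<close> with labels
  \<open>ws\<close> ends at \<open>g \<circ> reversal_word ws\<close>. On points the last letter
  acts first.\<close>

definition reversal_word :: "nat list \<Rightarrow> nat \<Rightarrow> nat" where
  "reversal_word ws = foldr (\<lambda>j h. r j \<circ> h) ws id"

lemma reversal_word_simps [simp]: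
  "reversal_word [] = id" "reversal_word (j # ws) = r j \<circ> reversal_word ws"
  by (simp_all add: reversal_word_def)

lemma reversal_word_append: "reversal_word (us @ vs) = reversal_word us \<circ> reversal_word vs"
  by (induction us) (auto simp: comp_assoc)

text \<open>Conjugation by the involution \<open>r j\<close> moves the base point of a closed walk
  one step along it.\<close>

lemma reversal_word_rotate:
  assumes "reversal_word (j # ws) = id"
  shows "reversal_word (ws @ [j]) = id"
proof -
  have "reversal_word ws p = r j p" for p
    using fun_cong[OF assms, of p] by simp (metis prefix_reversal_cancel)
  then show ?thesis by (simp add: reversal_word_append fun_eq_iff)
qed

subsection \<open>Closed walks of length 6 and 7\<close>

text \<open>For \<open>j < m\<close> the conjugate \<open>r m \<circ> r j \<circ> r m\<close> fixes
  1. Isolating each of the three conjugates and evaluating at 1 makes any two of \<open>a\<close>,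
  \<open>b\<close>, \<open>c\<close> add up to \<open>m + 1\<close>, so all three are equal.\<close>

lemma three_max_hexagon:
  assumes "2 \<le> a" "a < m" "2 \<le> b" "b < m" "2 \<le> c" "c < m"
    and w: "\<And>p. r m (r a (r m (r b (r m (r c p))))) = p"
  shows "m \<le> 3"
proof -
  have wa: "r b (r m (r c p)) = r m (r a (r m p))" for p
    using w[of p] by (metis prefix_reversal_cancel)
  have wb: "r c (r m (r a p)) = r m (r b (r m p))" for p
    using w[of "r c (r m (r b (r m p)))"] by (metis prefix_reversal_cancel)
  have wc: "r a (r m (r b p)) = r m (r c (r m p))" for p
    using w[of "r c (r m p)"] by (metis prefix_reversal_cancel)
  have flip: "r m (r j (r m 1)) = 1" "r j 1 = j" "r m j = m + 1 - j"
    and eq1: "r j p = 1 \<longleftrightarrow> p = j" if "2 \<le> j" "j < m" for j p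
    using that prefix_reversal_eq_1_iff[of j p]
    by (simp_all add: prefix_reversal_at_1 prefix_reversal_at_end prefix_reversal_outside
        prefix_reversal_inside)
  have "m + 1 - c = b" "m + 1 - a = c" "m + 1 - b = a"
    using wa[of 1] wb[of 1] wc[of 1] assms(1-6) by (simp_all add: flip eq1)
  then have m: "a = c" "b = c" "m + 1 = 2 * c"
    using assms(1-6) by auto
  show ?thesis
  proof (rule ccontr)
    assume "\<not> m \<le> 3"
    then have "3 \<le> c" "c + 2 \<le> m" using m by simp_all
    \<comment> \<open>At the point 2 the sides of \<open>wa\<close> disagree: one gives 2, the other
      \<open>c + 1\<close>.\<close>
    then have "r m (r c (r m 2)) = 2" "r c 2 = c - 1" "r m (c - 1) = c + 1" "r c (c + 1) = c + 1"
      using m by (auto simp: prefix_reversal_inside prefix_reversal_outside)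
    then show False using wa[of 2] m \<open>3 \<le> c\<close> by simp
  qed
qed

text \<open>The neighbours of the leading \<open>m\<close> are smaller, so its other occurrences are
  among \<open>b\<close>, \<open>c\<close>, \<open>d\<close>. Fewer than three in all are refuted by
  following the point \<open>m\<close> or 1 through the word.\<close>

lemma hexagon_no_large_max:
  assumes w: "reversal_word [m, a, b, c, d, e] = id"
    and ge: "2 \<le> a" "2 \<le> b" "2 \<le> c" "2 \<le> d" "2 \<le> e"
    and le: "a \<le> m" "b \<le> m" "c \<le> m" "d \<le> m" "e \<le> m"
    and ne: "m \<noteq> a" "a \<noteq> b" "b \<noteq> c" "c \<noteq> d" "d \<noteq> e" "e \<noteq> m"
  shows "m \<le> 3"
proof -
  have p: "r m (r a (r b (r c (r d (r e p))))) = p" for p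
    using fun_cong[OF w, of p] by simp
  have lt: "a < m" "e < m" using le ne by auto
  consider "b = m" "d = m" | "b = m" "c < m" "d < m" | "b < m" "c = m" "d < m"
    | "b < m" "c < m" "d = m" | "b < m" "c < m" "d < m"
    using le(2-4) ne(3,4) by (metis le_neq_implies_less)
  then show ?thesis
  proof cases
    case 1
    show ?thesis
      by (rule three_max_hexagon[OF _ _ _ _ _ _ p[unfolded 1]]) (use ge lt le ne 1 in auto)
  next
    case 2
    then have "r c (r d (r e m)) = m" "r m (r a (r m m)) = m + 1 - a"
      using ge lt by (simp_all add: prefix_reversal_outside prefix_reversal_at_end
          prefix_reversal_at_1 prefix_reversal_inside)
    then show ?thesis using p[of m] 2 ge lt by simp
  next
    case 3
    then have "r d (r e m) = m" "r b (r m m) = b"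
      using ge lt by (simp_all add: prefix_reversal_outside prefix_reversal_at_end prefix_reversal_at_1)
    \<comment> \<open>The letters between the two occurrences of \<open>m\<close> would have to fix
      1, forcing \<open>a = b\<close>.\<close>
    then have "r m (r a b) = m" using p[of m] 3 by simp
    then show ?thesis
      using ge ne prefix_reversal_eq_end_iff[of m] prefix_reversal_eq_1_iff[of a] lt by simp
  next
    case 4
    \<comment> \<open>Following 1 instead of \<open>m\<close>: smaller reversals keep
      \<open>r m e\<close> below \<open>m\<close>, but the leading \<open>r m\<close> returns 1 only
      from \<open>m\<close>.\<close>
    have "r m e < m" using ge lt by (simp add: prefix_reversal_inside)
    then have "r a (r b (r c (r m e))) < m" using 4 lt by (simp add: prefix_reversal_less)
    moreover have "r m (r a (r b (r c (r m e)))) = 1"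
      using p[of 1] 4 ge by (simp add: prefix_reversal_at_1)
    ultimately show ?thesis
      using lt ge prefix_reversal_eq_1_iff[of m] by simp
  next
    case 5
    then have "r a (r b (r c (r d (r e m)))) = m"
      using lt by (simp add: prefix_reversal_outside)
    then show ?thesis using p[of m] lt ge by (simp add: prefix_reversal_at_end)
  qed
qed

text \<open>Rotation brings a maximal letter to the front, and a bound on it bounds all
  letters.\<close>

lemma hexagon_labels:
  assumes "reversal_word [a1, a2, a3, a4, a5, a6] = id"
    and "2 \<le> a1" "2 \<le> a2" "2 \<le> a3" "2 \<le> a4" "2 \<le> a5" "2 \<le> a6"
    and "a1 \<noteq> a2" "a2 \<noteq> a3" "a3 \<noteq> a4" "a4 \<noteq> a5" "a5 \<noteq> a6" "a6 \<noteq> a1"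
  shows "a1 \<le> 3 \<and> a2 \<le> 3"
proof -
  note w1 = assms(1)
  note w2 = reversal_word_rotate[OF w1, unfolded append.simps]
  note w3 = reversal_word_rotate[OF w2, unfolded append.simps]
  note w4 = reversal_word_rotate[OF w3, unfolded append.simps]
  note w5 = reversal_word_rotate[OF w4, unfolded append.simps]
  note w6 = reversal_word_rotate[OF w5, unfolded append.simps]
  define m where "m = Max {a1, a2, a3, a4, a5, a6}"
  have le: "a1 \<le> m" "a2 \<le> m" "a3 \<le> m" "a4 \<le> m" "a5 \<le> m" "a6 \<le> m"
    unfolding m_def by (auto intro!: Max_ge)
  have "m \<in> {a1, a2, a3, a4, a5, a6}" unfolding m_def by (rule Max_in) auto
  then consider "m = a1" | "m = a2" | "m = a3" | "m = a4" | "m = a5" | "m = a6" by blast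
  then have "m \<le> 3"
  proof cases
    case 1 show ?thesis unfolding 1 by (rule hexagon_no_large_max[OF w1]) (use assms(2-) le in \<open>simp_all add: 1\<close>)
  next
    case 2 show ?thesis unfolding 2 by (rule hexagon_no_large_max[OF w2]) (use assms(2-) le in \<open>simp_all add: 2\<close>)
  next
    case 3 show ?thesis unfolding 3 by (rule hexagon_no_large_max[OF w3]) (use assms(2-) le in \<open>simp_all add: 3\<close>)
  next
    case 4 show ?thesis unfolding 4 by (rule hexagon_no_large_max[OF w4]) (use assms(2-) le in \<open>simp_all add: 4\<close>)
  next
    case 5 show ?thesis unfolding 5 by (rule hexagon_no_large_max[OF w5]) (use assms(2-) le in \<open>simp_all add: 5\<close>)
  next
    case 6 show ?thesis unfolding 6 by (rule hexagon_no_large_max[OF w6]) (use assms(2-) le in \<open>simp_all add: 6\<close>)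
  qed
  then show ?thesis using le by simp
qed

text \<open>\<open>r 2\<close> and \<open>r 3\<close> are the transpositions (1 2) and (1 3), whose
  product has order 3.\<close>

lemma hexagon_word: "reversal_word [2, 3, 2, 3, 2, 3] = id" "reversal_word [3, 2, 3, 2, 3, 2] = id"
proof -
  have "r 2 p = (if p = 1 then 2 else if p = 2 then 1 else p)"
    "r 3 p = (if p = 1 then 3 else if p = 3 then 1 else p)" for p
    by (auto simp: prefix_reversal_def)
  then show "reversal_word [2, 3, 2, 3, 2, 3] = id" "reversal_word [3, 2, 3, 2, 3, 2] = id"
    by (simp_all add: fun_eq_iff)
qed

text \<open>\<open>r k \<circ> r (k - 1)\<close> is the cyclic shift by 1 on 1..k; it occurs twice,
  and the last three letters undo the shift by 2.\<close>

lemma heptagon_word: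
  assumes "4 \<le> k"
  shows "reversal_word [k, k - 1, k, k - 1, k - 2, k, 2] = id"
proof -
  have shift: "r k (r (k - 1) p) = (if p = k then 1 else if 1 \<le> p \<and> p < k then p + 1 else p)" for p
    using assms by (auto simp: prefix_reversal_def)
  have unshift: "r (k - 2) (r k (r 2 p)) =
      (if p = 1 then k - 1 else if p = 2 then k else if 3 \<le> p \<and> p \<le> k then p - 2 else p)" for p
  proof -
    consider "p = 1" | "p = 2" | "3 \<le> p" "p \<le> k" | "p = 0" | "k < p" by linarith
    then show ?thesis
    proof cases
      case 1
      then show ?thesis using assms by (auto simp: prefix_reversal_def)
    next
      case 3
      then have "r 2 p = p" "r k p = k + 1 - p" "r (k - 2) (k + 1 - p) = p - 2"
        using assms by (auto simp: prefix_reversal_def)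
      then show ?thesis using 3 by simp
    qed (use assms in \<open>simp_all add: prefix_reversal_def\<close>)
  qed
  have "reversal_word [k, k - 1, k, k - 1, k - 2, k, 2] p = p" for p
  proof -
    consider "p = 1" | "p = 2" | "3 \<le> p" "p \<le> k" | "p = 0 \<or> k < p" by linarith
    then show ?thesis
      using assms by cases (auto simp: shift unshift)
  qed
  then show ?thesis by (simp only: fun_eq_iff id_apply) simp
qed

text \<open>For \<open>j + 2 \<le> m\<close> the conjugate
  \<open>r m \<circ> r j \<circ> r m\<close> fixes both 1 and 2. Isolating the conjugates of
  \<open>r b\<close> and \<open>r a\<close> and evaluating at 1 and 2 gives incompatible
  equations.\<close>

lemma three_max_heptagon:
  assumes "2 \<le> a" "2 \<le> b" "2 \<le> c" "2 \<le> d"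
    and "a + 2 \<le> m" "b + 2 \<le> m" "c + 2 \<le> m" "d + 2 \<le> m"
    and w: "\<And>p. r m (r a (r m (r c (r d (r m (r b p)))))) = p"
  shows False
proof -
  have wb: "r d (r c (r m (r a p))) = r m (r b (r m p))" for p
    using w[of "r b (r m (r d (r c (r m (r a p)))))"] by (metis prefix_reversal_cancel)
  have wa: "r b (r m (r d (r c p))) = r m (r a (r m p))" for p
    using w[of "r b (r m (r d (r c p)))"] by (metis prefix_reversal_cancel)
  note e = prefix_reversal_def
  have fixed: "r m (r b (r m 1)) = 1" "r m (r b (r m 2)) = 2"
    "r m (r a (r m 1)) = 1" "r m (r a (r m 2)) = 2"
    using assms(1-8) by (auto simp: e)
  have "r m (r a 1) = r c (r d 1)" "r m (r a 2) = r c (r d 2)"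
    using wb[of 1] wb[of 2] unfolding fixed by (metis prefix_reversal_cancel)+
  then have "r m (r a 1) = r c d" "r m (r a 2) = r c (d - 1)"
    using assms(1-8) by (simp_all add: e[of d] One_nat_def)
  moreover have "r m (r a 1) = m + 1 - a" "r m (r a 2) = m + 2 - a"
    using assms(1-8) by (auto simp: prefix_reversal_inside)
  ultimately have ca: "r c d = m + 1 - a" "r c (d - 1) = m + 2 - a"
    by simp_all
  \<comment> \<open>By \<open>ca\<close>, \<open>r c\<close> swaps the order of the neighbours
    \<open>d - 1\<close> and \<open>d\<close>, so both lie in the reversed prefix;
    \<open>a + 2 \<le> m\<close> then separates \<open>d\<close> from \<open>c\<close>.\<close>
  have c: "c + a = d + m" "d + 1 < c"
  proof -
    consider "d \<le> c" | "d = c + 1" | "c + 1 < d" by linarith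
    then have "c + a = d + m"
      using ca assms(1-8) by cases (simp_all add: prefix_reversal_inside prefix_reversal_outside)
    then show "c + a = d + m" "d + 1 < c" using assms(1-8) by simp_all
  qed
  have "r c 1 = c" "r d c = c" "r m c = m + 1 - c"
    using assms(1-8) c(2) by (simp_all add: prefix_reversal_inside prefix_reversal_outside)
  then have "r b (m + 1 - c) = 1"
    using wa[of 1] fixed by simp
  then have m: "m + 1 - c = b"
    using assms(2) by (simp add: prefix_reversal_eq_1_iff)
  \<comment> \<open>Since \<open>m + 2 - c = b + 1\<close> lies just beyond the prefix of length
    \<open>b\<close>, \<open>r b\<close> fixes it.\<close>
  have "r c 2 = c - 1" "r d (c - 1) = c - 1" "r m (c - 1) = m + 2 - c" "r b (m + 2 - c) = m + 2 - c"
    using assms(1-8) c(2) m by (auto simp: prefix_reversal_inside prefix_reversal_outside)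
  then have "m + 2 - c = 2"
    using wa[of 2] fixed by simp
  then show False
    using assms(1-8) by simp
qed

text \<open>The maximum \<open>m\<close> occurs only among \<open>x\<close>, \<open>y\<close>,
  \<open>z\<close>, and fewer than three occurrences are refuted by following \<open>m\<close> or 1.
  If \<open>k < m\<close>, the small letters are at most \<open>m - 2\<close>, the case just
  excluded.\<close>

lemma heptagon_large_labels:
  assumes w: "reversal_word [x, a, y, c, d, z, b] = id"
    and ge: "2 \<le> a" "2 \<le> b" "2 \<le> c" "2 \<le> d"
    and lt: "a < k" "b < k" "c < k" "d < k"
    and big: "k \<le> x" "k \<le> y" "k \<le> z"
    and ne: "c \<noteq> d"
  shows "x = k"
proof -
  have p: "r x (r a (r y (r c (r d (r z (r b p)))))) = p" for p
    using fun_cong[OF w, of p] by simp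
  define m where "m = max x (max y z)"
  have "x \<le> m" "y \<le> m" "z \<le> m" and m_in: "x = m \<or> y = m \<or> z = m"
    by (simp_all add: m_def max_def)
  then have le_m: "x = m \<or> x < m" "y = m \<or> y < m" "z = m \<or> z < m"
    by (simp_all add: le_less disj_commute)
  have le: "k \<le> m" "a < m" "b < m" "c < m" "d < m" "1 < m"
    using \<open>x \<le> m\<close> lt big(1) ge(1) by linarith+
  have fix_m: "r j m = m" if "j < m" for j
    using that by (simp add: prefix_reversal_outside)
  have at_end: "r m m = 1" and m_iff: "r m q = m \<longleftrightarrow> q = 1" "r m q = 1 \<longleftrightarrow> q = m" for q
    using le(6) by (simp_all add: prefix_reversal_at_end prefix_reversal_eq_end_iff
        prefix_reversal_eq_1_iff)
  have at_1: "r a 1 = a" "r b 1 = b" "r d 1 = d" and a_iff: "r a 1 \<noteq> 1"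
    using ge by (simp_all add: prefix_reversal_at_1)
  note less = prefix_reversal_less
  consider "x = m" "y = m" "z = m" | "x = m" "y < m" "z < m" | "x < m" "y = m" "z < m"
    | "x < m" "y < m" "z = m" | "x = m" "y = m" "z < m" | "x < m" "y = m" "z = m"
    | "x = m" "y < m" "z = m"
    using le_m m_in by blast
  then show ?thesis
  proof cases
    case 1
    have "\<not> k < m"
    proof
      assume "k < m"
      then show False
        using lt by (intro three_max_heptagon[OF ge _ _ _ _ p[unfolded 1]]) simp_all
    qed
    then show ?thesis using 1 le by simp
  next
    case 2
    then have "r a (r y (r c (r d (r z (r b m))))) = m" by (simp add: fix_m le)
    then show ?thesis using p[of m] 2 at_end le by simp
  next
    case 3
    then have "r c (r d (r z (r b m))) = m" by (simp add: fix_m le)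
    then have "r x (r a 1) = m" using p[of m] 3 at_end by simp
    moreover have "r x (r a 1) < m" using 3 le by (intro less)
    ultimately show ?thesis by simp
  next
    case 4
    have "r b m = m" by (simp add: fix_m le)
    then have "r x (r a (r y (r c (r d 1)))) = m" using p[of m] 4 at_end by simp
    moreover have "r x (r a (r y (r c (r d 1)))) < m" using 4 le by (intro less)
    ultimately show ?thesis by simp
  next
    case 5
    then have "r c (r d (r z (r b m))) = m" by (simp add: fix_m le)
    then have "r m (r a 1) = m" using p[of m] 5 at_end by simp
    then show ?thesis using m_iff a_iff by simp
  next
    case 6
    have "r b m = m" by (simp add: fix_m le)
    then have eq: "r x (r a (r m (r c d))) = m" using p[of m] 6 at_end at_1 by simp
    \<comment> \<open>As \<open>c \<noteq> d\<close>, the letters between \<open>y\<close> and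
      \<open>z\<close> move 1, so the \<open>r m\<close> at \<open>y\<close> does not lead back to
      \<open>m\<close>.\<close>
    have "r c d \<noteq> 1"
      using ge(3) ne prefix_reversal_eq_1_iff[of c d] by simp
    moreover have "1 \<le> r c d"
      using ge(4) by (auto simp: prefix_reversal_def)
    moreover have "r c d < m" using le by (intro less)
    ultimately have "r m (r c d) < m" by (simp add: prefix_reversal_inside)
    then have "r x (r a (r m (r c d))) < m" by (rule less[OF less[OF _ le(2)] 6(1)])
    then show ?thesis using eq by simp
  next
    case 7
    \<comment> \<open>From 1 the value drops below \<open>m\<close> at \<open>z\<close> and cannot
      climb back before the final \<open>r m\<close>.\<close>
    have "r m b < m" using ge le by (simp add: prefix_reversal_inside)
    then have "r a (r y (r c (r d (r m b)))) < m"
      by (rule less[OF less[OF less[OF less[OF _ le(5)] le(4)] 7(2)] le(2)])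
    moreover have "r m (r a (r y (r c (r d (r m b))))) = 1"
      using p[of 1] 7 at_1 by simp
    ultimately show ?thesis using m_iff by simp
  qed
qed

text \<open>With \<open>t = 3\<close> the word sends 1 to 5 if \<open>s = 2\<close>, and to 3 if
  \<open>s = 3\<close>.\<close>

lemma heptagon5_small_labels:
  assumes "reversal_word [5, 4, 5, 4, s, 5, t] = id" "s \<in> {2, 3}" "t \<in> {2, 3}"
  shows "t = 2"
proof -
  have p: "r 5 (r 4 (r 5 (r 4 (r s (r 5 (r t p)))))) = p" for p
    using fun_cong[OF assms(1), of p] by simp
  have "r 5 (r 4 (r 5 (r 4 (r 2 (r 5 (r 3 1)))))) \<noteq> 1"
    "r 5 (r 4 (r 5 (r 4 (r 3 (r 5 (r 3 1)))))) \<noteq> 1"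
    by (simp_all add: prefix_reversal_def)
  then show ?thesis using p[of 1] assms(2,3) by blast
qed

subsection \<open>Labels under an automorphism\<close>

lemma prefix_reversal_permutes: "j \<le> n \<Longrightarrow> r j permutes {1..n}"
  using prefix_reversal_in_sym_group sym_group_carrier by blast

text \<open>Pancake sorting: the flips \<open>r x\<close> and \<open>r (Suc m)\<close> bring the
  point \<open>x = p (Suc m)\<close> to \<open>Suc m\<close>, leaving a permutation of 1..m. This is
  generation by reversals, phrased for invariants.\<close>

lemma prefix_reversal_invariant:
  assumes closed: "\<And>g j. g \<in> V \<Longrightarrow> 2 \<le> j \<Longrightarrow> j \<le> m \<Longrightarrow> g \<circ> r j \<in> V"
    and inv: "\<And>g j. g \<in> V \<Longrightarrow> 2 \<le> j \<Longrightarrow> j \<le> m \<Longrightarrow> F (g \<circ> r j) = F g"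
    and "p permutes {1..m}" "g \<in> V"
  shows "F (g \<circ> p) = F g"
  using assms
proof (induction m arbitrary: p g)
  case 0
  show ?case using 0(3) by simp
next
  case (Suc m)
  define x where "x = p (Suc m)"
  have x: "1 \<le> x" "x \<le> Suc m"
    using permutes_in_image[OF Suc.prems(3), of "Suc m"] by (auto simp: x_def)
  have step: "g \<circ> r j \<in> V \<and> F (g \<circ> r j) = F g" if "g \<in> V" "1 \<le> j" "j \<le> Suc m" for g j
  proof (cases "j = 1")
    case True
    then show ?thesis using that by (simp add: prefix_reversal_1)
  next
    case False
    then have "2 \<le> j" using that by simp
    then show ?thesis by (intro conjI Suc.prems(1,2) that)
  qed
  define q where "q = r (Suc m) \<circ> (r x \<circ> p)"
  have "q permutes {1..Suc m}"
    unfolding q_def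
    by (rule permutes_compose[OF permutes_compose[OF Suc.prems(3) prefix_reversal_permutes[OF x(2)]]
          prefix_reversal_permutes[OF order_refl]])
  moreover have "q (Suc m) = Suc m"
    using x by (simp add: q_def x_def[symmetric] prefix_reversal_at_end prefix_reversal_at_1)
  then have "q y = y" if "y \<in> {1..Suc m} - {1..m}" for y
    using that by (cases "y = Suc m") auto
  ultimately have q: "q permutes {1..m}"
    by (rule permutes_superset)
  have V: "g \<circ> r x \<in> V" "g \<circ> r x \<circ> r (Suc m) \<in> V"
    and F: "F (g \<circ> r x \<circ> r (Suc m)) = F g"
    using step[OF Suc.prems(4) x] step[of "g \<circ> r x" "Suc m"] by simp_all
  have "g \<circ> p = (g \<circ> r x) \<circ> r (Suc m) \<circ> q"
    by (simp add: q_def fun_eq_iff)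
  moreover have "F \<dots> = F ((g \<circ> r x) \<circ> r (Suc m))"
    by (rule Suc.IH[OF Suc.prems(1,2) q V(2)]) simp_all
  ultimately show ?case
    by (simp only: F)
qed

text \<open>Each \<open>r j\<close> is an involution, so reversed arcs again have the form of
  forward arcs.\<close>

lemma pancake_arc_iff:
  "(u, v) \<in> parcs (pancake_graph n) \<longleftrightarrow> u permutes {1..n} \<and> (\<exists>j\<in>{2..n}. v = u \<circ> r j)"
proof -
  have "u = (u \<circ> r j) \<circ> r j" for u j by (simp add: fun_eq_iff)
  moreover have "u \<circ> r j permutes {1..n}" if "u permutes {1..n}" "j \<in> {2..n}" for u j
    using that prefix_reversal_in_sym_group[of j n]
    by (intro permutes_compose) (auto simp: sym_group_carrier)
  ultimately show ?thesis
    by (fastforce simp: pancake_graph_def cayley_graph_def prefix_reversals_def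
        sym_group_carrier sym_group_mult)
qed

lemma pancake_verts: "pverts (pancake_graph n) = {g. g permutes {1..n}}"
  by (simp add: pancake_graph_def cayley_graph_def sym_group_def)

lemma comp_prefix_reversal_permutes: "g permutes {1..n} \<Longrightarrow> j \<le> n \<Longrightarrow> g \<circ> r j permutes {1..n}"
  by (intro permutes_compose prefix_reversal_permutes)

lemma prefix_reversal_inj: "1 \<le> i \<Longrightarrow> 1 \<le> j \<Longrightarrow> r i = r j \<Longrightarrow> i = j"
  by (metis prefix_reversal_at_1)

section \<open>The label map of a fixed automorphism\<close>

locale pancake_automorphism =
  fixes n :: nat and f :: "(nat \<Rightarrow> nat) \<Rightarrow> nat \<Rightarrow> nat"
  assumes n_ge_5: "5 \<le> n" and automorphism: "f \<in> graph_aut (pancake_graph n)"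
begin

text \<open>On vertices \<open>g\<close> and \<open>j\<close> in 2..n the choice is unambiguous:
  distinct labels lead to distinct neighbours.\<close>

definition label :: "(nat \<Rightarrow> nat) \<Rightarrow> nat \<Rightarrow> nat" where
  "label g j = (SOME k. k \<in> {2..n} \<and> f (g \<circ> r j) = f g \<circ> r k)"

lemma f_permutes: "g permutes {1..n} \<Longrightarrow> f g permutes {1..n}"
  using automorphism Bij_imp_funcset by (force simp: graph_aut_def pancake_verts)

lemma f_inj: "g permutes {1..n} \<Longrightarrow> h permutes {1..n} \<Longrightarrow> f g = f h \<Longrightarrow> g = h"
  using automorphism by (auto simp: graph_aut_def pancake_verts Bij_def bij_betw_def inj_on_def)

lemma label:
  assumes "g permutes {1..n}" "j \<in> {2..n}"
  shows "2 \<le> label g j" "label g j \<le> n" "f (g \<circ> r j) = f g \<circ> r (label g j)"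
proof -
  have "(g, g \<circ> r j) \<in> parcs (pancake_graph n)"
    using assms by (auto simp: pancake_arc_iff)
  moreover have "g \<circ> r j permutes {1..n}"
    using assms by (simp add: comp_prefix_reversal_permutes)
  ultimately have "(f g, f (g \<circ> r j)) \<in> parcs (pancake_graph n)"
    using automorphism assms by (simp add: graph_aut_def pancake_verts)
  then have "\<exists>k. k \<in> {2..n} \<and> f (g \<circ> r j) = f g \<circ> r k"
    by (auto simp: pancake_arc_iff)
  then have "label g j \<in> {2..n} \<and> f (g \<circ> r j) = f g \<circ> r (label g j)"
    unfolding label_def by (rule someI_ex)
  then show "2 \<le> label g j" "label g j \<le> n" "f (g \<circ> r j) = f g \<circ> r (label g j)" by auto
qed

lemma comp_cancel: "g permutes {1..n} \<Longrightarrow> g \<circ> u = g \<circ> v \<Longrightarrow> u = v"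
  by (metis comp_assoc permutes_inv_o(2) id_comp)

lemma label_inj:
  assumes "g permutes {1..n}" "i \<in> {2..n}" "j \<in> {2..n}" "label g i = label g j"
  shows "i = j"
proof -
  have "f (g \<circ> r i) = f (g \<circ> r j)"
    using label(3) assms by metis
  then have "g \<circ> r i = g \<circ> r j"
    using f_inj comp_prefix_reversal_permutes assms by simp
  then have "r i = r j"
    using comp_cancel assms(1) by metis
  then show ?thesis
    using assms(2,3) by (intro prefix_reversal_inj) simp_all
qed

text \<open>An edge carries the same label in both directions, before and after applying
  \<open>f\<close>.\<close>

lemma label_back:
  assumes "g permutes {1..n}" "j \<in> {2..n}"
  shows "label (g \<circ> r j) j = label g j"
proof -
  let ?h = "g \<circ> r j"
  have h: "?h permutes {1..n}" using assms by (simp add: comp_prefix_reversal_permutes)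
  have "?h \<circ> r j = g" by (simp add: fun_eq_iff)
  then have "f g = f g \<circ> r (label g j) \<circ> r (label ?h j)"
    using label(3)[OF h assms(2)] label(3)[OF assms] by simp
  then have "id = r (label g j) \<circ> r (label ?h j)"
    using comp_cancel[OF f_permutes[OF assms(1)], of id] by (simp add: comp_assoc)
  then have "r (label ?h j) = r (label g j)"
    by (simp add: fun_eq_iff) (metis prefix_reversal_cancel)
  then show ?thesis
    using prefix_reversal_inj label(1)[OF assms] label(1)[OF h assms(2)] by simp
qed

text \<open>Image walks do not backtrack: by \<open>label_back\<close> the first label is also that
  of \<open>i\<close> at the new vertex, where labels are injective.\<close>

lemma label_step_neq:
  assumes "g permutes {1..n}" "i \<in> {2..n}" "j \<in> {2..n}" "i \<noteq> j"
  shows "label g i \<noteq> label (g \<circ> r i) j"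
proof -
  have "g \<circ> r i permutes {1..n}" using assms by (simp add: comp_prefix_reversal_permutes)
  then show ?thesis using label_inj label_back assms by metis
qed

fun labels :: "(nat \<Rightarrow> nat) \<Rightarrow> nat list \<Rightarrow> nat list" where
  "labels g [] = []"
| "labels g (j # js) = label g j # labels (g \<circ> r j) js"

lemma f_comp_word:
  assumes "g permutes {1..n}" "set js \<subseteq> {2..n}"
  shows "f (g \<circ> reversal_word js) = f g \<circ> reversal_word (labels g js)"
  using assms
proof (induction js arbitrary: g)
  case (Cons j js)
  have "f (g \<circ> reversal_word (j # js)) = f ((g \<circ> r j) \<circ> reversal_word js)"
    by (simp add: comp_assoc)
  also have "\<dots> = f (g \<circ> r j) \<circ> reversal_word (labels (g \<circ> r j) js)"
    using Cons.prems by (intro Cons.IH comp_prefix_reversal_permutes) simp_all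
  also have "f (g \<circ> r j) = f g \<circ> r (label g j)"
    using Cons.prems by (intro label) auto
  finally show ?case unfolding labels.simps reversal_word_simps comp_assoc .
qed simp

lemma closed_word_labels:
  assumes "g permutes {1..n}" "set js \<subseteq> {2..n}" "reversal_word js = id"
  shows "reversal_word (labels g js) = id"
  using f_comp_word[OF assms(1,2)] assms(3) comp_cancel[OF f_permutes[OF assms(1)], of _ id] by simp

lemma label_hexagon:
  assumes g: "g permutes {1..n}" and w: "reversal_word [i, j, i, j, i, j] = id"
    and ij: "i \<in> {2..n}" "j \<in> {2..n}" "i \<noteq> j"
  shows "label g i \<le> 3"
proof -
  \<comment> \<open>These are the vertices of a hexagon through \<open>g\<close>; its image is a
    closed walk without backtracking.\<close>
  define g1 where "g1 = g \<circ> r i"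
  define g2 where "g2 = g1 \<circ> r j"
  define g3 where "g3 = g2 \<circ> r i"
  define g4 where "g4 = g3 \<circ> r j"
  define g5 where "g5 = g4 \<circ> r i"
  note defs = g1_def g2_def g3_def g4_def g5_def
  have perm: "g1 permutes {1..n}" "g2 permutes {1..n}" "g3 permutes {1..n}"
    "g4 permutes {1..n}" "g5 permutes {1..n}"
    using g ij by (simp_all add: defs comp_prefix_reversal_permutes)
  have closed: "g5 \<circ> r j = g"
    using w by (simp add: defs comp_assoc)
  have sub: "set [i, j, i, j, i, j] \<subseteq> {2..n}" using ij by simp
  note step_i = label_step_neq[OF _ ij] and step_j = label_step_neq[OF _ ij(2,1) ij(3)[symmetric]]
  have "label g5 j \<noteq> label g i"
    using step_j[OF perm(5)] unfolding closed .
  moreover have "label g i \<noteq> label g1 j" unfolding g1_def by (rule step_i[OF g])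
  moreover have "label g1 j \<noteq> label g2 i" unfolding g2_def by (rule step_j[OF perm(1)])
  moreover have "label g2 i \<noteq> label g3 j" unfolding g3_def by (rule step_i[OF perm(2)])
  moreover have "label g3 j \<noteq> label g4 i" unfolding g4_def by (rule step_j[OF perm(3)])
  moreover have "label g4 i \<noteq> label g5 j" unfolding g5_def by (rule step_i[OF perm(4)])
  moreover have "reversal_word [label g i, label g1 j, label g2 i, label g3 j, label g4 i, label g5 j] = id"
    using closed_word_labels[OF g sub w] by (simp only: labels.simps defs)
  ultimately show ?thesis
    by (intro hexagon_labels[THEN conjunct1, OF _ label(1)[OF g ij(1)] label(1)[OF perm(1) ij(2)]
          label(1)[OF perm(2) ij(1)] label(1)[OF perm(3) ij(2)] label(1)[OF perm(4) ij(1)]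
          label(1)[OF perm(5) ij(2)]])
qed

text \<open>Pigeonhole: \<open>label g\<close> permutes 2..k, so no value there is left for a larger
  \<open>j\<close>.\<close>

lemma label_le_imp_label_gt:
  assumes g: "g permutes {1..n}" and le: "\<And>j. 2 \<le> j \<Longrightarrow> j \<le> k \<Longrightarrow> label g j \<le> k"
    and "k \<le> n" "k < j" "2 \<le> j" "j \<le> n"
  shows "k < label g j"
proof (rule ccontr)
  assume "\<not> k < label g j"
  have inj: "inj_on (label g) {2..k}"
    using label_inj[OF g] assms(3) by (auto simp: inj_on_def)
  have "label g ` {2..k} \<subseteq> {2..k}"
    using le label(1)[OF g] assms(3) by auto
  then have "label g ` {2..k} = {2..k}"
    using inj by (simp add: endo_inj_surj)
  moreover have "label g j \<in> {2..k}"
    using \<open>\<not> k < label g j\<close> label(1)[OF g] assms by simp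
  ultimately obtain i where "i \<in> {2..k}" "label g i = label g j" by (metis imageE)
  then show False using label_inj[OF g, of i j] assms by auto
qed

text \<open>On the 7-cycle from \<open>g\<close>, letters below \<open>k\<close> keep labels below
  \<open>k\<close>, and by counting the letter \<open>k\<close> gets labels at least
  \<open>k\<close>.\<close>

lemma label_next:
  assumes le: "\<And>g j. g permutes {1..n} \<Longrightarrow> 2 \<le> j \<Longrightarrow> j < k \<Longrightarrow> label g j < k"
    and k: "4 \<le> k" "k \<le> n" and g: "g permutes {1..n}"
  shows "label g k = k"
proof -
  define g1 where "g1 = g \<circ> r k"
  define g2 where "g2 = g1 \<circ> r (k - 1)"
  define g3 where "g3 = g2 \<circ> r k"
  define g4 where "g4 = g3 \<circ> r (k - 1)"
  define g5 where "g5 = g4 \<circ> r (k - 2)"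
  define g6 where "g6 = g5 \<circ> r k"
  note defs = g1_def g2_def g3_def g4_def g5_def g6_def
  have perm: "g1 permutes {1..n}" "g2 permutes {1..n}" "g3 permutes {1..n}"
    "g4 permutes {1..n}" "g5 permutes {1..n}" "g6 permutes {1..n}"
    using g k by (simp_all add: defs comp_prefix_reversal_permutes)
  have big: "k \<le> label h k" if "h permutes {1..n}" for h
    using label_le_imp_label_gt[OF that, of "k - 1" k] le[OF that] k by fastforce
  have ge_2: "2 \<le> label h j" if "h permutes {1..n}" "2 \<le> j" "j < k" for h j
    using label(1)[OF that(1)] that k by simp
  have sub: "set [k, k - 1, k, k - 1, k - 2, k, 2] \<subseteq> {2..n}" using k by auto
  have "reversal_word [label g k, label g1 (k - 1), label g2 k, label g3 (k - 1),
      label g4 (k - 2), label g5 k, label g6 2] = id"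
    using closed_word_labels[OF g sub heptagon_word[OF k(1)]] by (simp only: labels.simps defs)
  moreover have "label g3 (k - 1) \<noteq> label g4 (k - 2)"
    unfolding g4_def using perm k by (intro label_step_neq) auto
  ultimately show ?thesis
    using perm g k big le ge_2
    by (intro heptagon_large_labels[of _ "label g1 (k - 1)" "label g2 k" "label g3 (k - 1)"
          "label g4 (k - 2)" "label g5 k" "label g6 2"]) auto
qed

text \<open>Hexagons settle \<open>k = 4\<close>; in the induction step \<open>label_next\<close>
  handles the new letter \<open>k\<close>.\<close>

lemma label_less:
  assumes "4 \<le> k" "k \<le> Suc n" "g permutes {1..n}" "2 \<le> j" "j < k"
  shows "label g j < k"
  using assms
proof (induction k arbitrary: g j rule: dec_induct)
  case base
  have 23: "2 \<in> {2..n}" "3 \<in> {2..n}" "(2::nat) \<noteq> 3" "(3::nat) \<noteq> 2" using n_ge_5 by auto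
  have "label g 2 \<le> 3" "label g 3 \<le> 3"
    using label_hexagon[OF base(2) hexagon_word(1) 23(1,2,3)]
      label_hexagon[OF base(2) hexagon_word(2) 23(2,1,4)] .
  moreover have "j = 2 \<or> j = 3" using base by auto
  ultimately show ?case by auto
next
  case (step k)
  have le: "label h i < k" if "h permutes {1..n}" "2 \<le> i" "i < k" for h i
    using step.IH[OF _ that] step.prems(1) by simp
  show ?case
  proof (cases "j = k")
    case True
    have "label g k = k" using step by (intro label_next[OF le]) simp_all
    then show ?thesis using True by simp
  next
    case False
    then have "label g j < k" using step.prems by (intro le) simp_all
    then show ?thesis by simp
  qed
qed

lemma label_large:
  assumes "g permutes {1..n}" "4 \<le> k" "k \<le> n"
  shows "label g k = k"
  by (rule label_next[OF label_less]) (use assms in simp_all)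

lemma label_2:
  assumes g: "g permutes {1..n}"
  shows "label g 2 = 2"
proof -
  have small: "label h 2 \<in> {2, 3}" "label h 3 \<in> {2, 3}" if "h permutes {1..n}" for h
  proof -
    have "label h 2 < 4" "label h 3 < 4" using that n_ge_5 by (auto intro!: label_less)
    moreover have "2 \<le> label h 2" "2 \<le> label h 3" using label(1)[OF that] n_ge_5 by auto
    ultimately show "label h 2 \<in> {2, 3}" "label h 3 \<in> {2, 3}" by auto
  qed
  \<comment> \<open>Walking the 7-cycle 5, 4, 5, 4, 3, 5, 2 backwards from \<open>g\<close> makes
    its last edge run from \<open>g \<circ> r 2\<close> to \<open>g\<close>.\<close>
  define g0 where "g0 = g \<circ> reversal_word [2, 5, 3, 4, 5, 4, 5]"
  note perm = comp_prefix_reversal_permutes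
  have g0: "g0 permutes {1..n}" using g n_ge_5 by (simp add: g0_def perm flip: comp_assoc)
  have g0_back: "g0 \<circ> r 5 \<circ> r 4 \<circ> r 5 \<circ> r 4 \<circ> r 3 \<circ> r 5 = g \<circ> r 2"
    by (simp add: g0_def fun_eq_iff)
  let ?h = "g0 \<circ> r 5 \<circ> r 4 \<circ> r 5 \<circ> r 4"
  have "reversal_word [5, 4, 5, 4, 3, 5, 2] = id"
    using heptagon_word[of 5] by simp
  then have "reversal_word (labels g0 [5, 4, 5, 4, 3, 5, 2]) = id"
    using n_ge_5 by (intro closed_word_labels[OF g0]) auto
  moreover have "labels g0 [5, 4, 5, 4, 3, 5, 2] = [5, 4, 5, 4, label ?h 3, 5, label (g \<circ> r 2) 2]"
    using n_ge_5 g0 by (simp add: label_large perm g0_back)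
  ultimately have "reversal_word [5, 4, 5, 4, label ?h 3, 5, label (g \<circ> r 2) 2] = id"
    by (simp only:)
  then have "label (g \<circ> r 2) 2 = 2"
    by (rule heptagon5_small_labels) (use small g g0 n_ge_5 in \<open>simp_all add: perm\<close>)
  then show ?thesis using label_back[OF g, of 2] n_ge_5 by simp
qed

lemma f_comp_prefix_reversal:
  assumes g: "g permutes {1..n}" and j: "2 \<le> j" "j \<le> n"
  shows "f (g \<circ> r j) = f g \<circ> r j"
proof -
  consider "j = 2" | "j = 3" | "4 \<le> j" using j by linarith
  then have "label g j = j"
  proof cases
    \<comment> \<open>Of the values 2 and 3 allowed for label 3, the first is already taken.\<close>
    case 2
    have "label g 3 < 4" using g n_ge_5 by (intro label_less) simp_all
    moreover have "2 \<le> label g 3" using label(1)[OF g, of 3] n_ge_5 by simp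
    moreover have "label g 3 \<noteq> 2" using label_inj[OF g, of 2 3] label_2[OF g] n_ge_5 by auto
    ultimately show ?thesis using 2 by simp
  qed (use label_2 label_large g j in auto)
  then show ?thesis using label(3)[OF g, of j] j by simp
qed

lemma f_eq_comp:
  assumes g: "g permutes {1..n}"
  shows "f g = f id \<circ> g"
proof -
  \<comment> \<open>The compositions with \<open>id\<close> match
    \<open>F (g \<circ> p) = F g\<close> at base point \<open>id\<close>.\<close>
  have "f (id \<circ> g) \<circ> inv' (id \<circ> g) = f id \<circ> inv' id"
  proof (rule prefix_reversal_invariant[where V = "{g. g permutes {1..n}}" and m = n
        and F = "\<lambda>g. f g \<circ> inv' g"])
    fix h j assume h: "h \<in> {g. g permutes {1..n}}" and j: "2 \<le> j" "j \<le> n"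
    show "h \<circ> r j \<in> {g. g permutes {1..n}}"
      using h j by (simp add: comp_prefix_reversal_permutes)
    have "inv' (h \<circ> r j) = r j \<circ> inv' h"
      using h by (intro inv_unique_comp) (simp_all add: fun_eq_iff permutes_inverses)
    moreover have "f (h \<circ> r j) = f h \<circ> r j" using f_comp_prefix_reversal h j by simp
    ultimately show "f (h \<circ> r j) \<circ> inv' (h \<circ> r j) = f h \<circ> inv' h"
      by (simp add: fun_eq_iff)
  qed (use g in \<open>simp_all add: permutes_id\<close>)
  then have *: "f g \<circ> inv' g = f id" by simp
  have "f g = f g \<circ> inv' g \<circ> g" using g by (simp add: comp_assoc permutes_inv_o)
  then show ?thesis unfolding * .
qed

end

section \<open>Left multiplications and the full automorphism group\<close>

lemma left_mult_graph_aut: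
  assumes y: "y permutes {1..n}"
  shows "left_mult (sym_group n) y \<in> graph_aut (pancake_graph n)"
proof -
  let ?V = "{g. g permutes {1..n}}"
  have eq: "left_mult (sym_group n) y = (\<lambda>g\<in>?V. y \<circ> g)"
    by (simp add: left_mult_def sym_group_def)
  have "bij_betw (\<lambda>g. y \<circ> g) ?V ?V"
    using y by (intro bij_betw_byWitness[where f' = "\<lambda>g. inv' y \<circ> g"])
      (auto simp: permutes_compose permutes_inv fun_eq_iff permutes_inverses)
  then have "(\<lambda>g\<in>?V. y \<circ> g) \<in> Bij ?V"
    by (simp add: Bij_def bij_betw_restrict_eq)
  \<comment> \<open>Left multiplication commutes with right multiplication and can be cancelled, so
    it preserves labels.\<close>
  moreover have "y \<circ> v = y \<circ> u \<circ> r j \<longleftrightarrow> v = u \<circ> r j" for u v j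
    using permutes_inj[OF y] by (auto simp: fun_eq_iff inj_eq)
  ultimately show ?thesis
    using y by (auto simp: eq graph_aut_def pancake_verts pancake_arc_iff permutes_compose)
qed

theorem theorem3p2:
  fixes n :: nat
  assumes "n \<ge> 5"
  shows "graph_aut (pancake_graph n) = left_regular (sym_group n)"
proof
  show "graph_aut (pancake_graph n) \<subseteq> left_regular (sym_group n)"
  proof
    fix f assume f: "f \<in> graph_aut (pancake_graph n)"
    then interpret pancake_automorphism n f using assms by unfold_locales
    \<comment> \<open>Equality as functions also needs agreement off the vertex set.\<close>
    have "f \<in> extensional {g. g permutes {1..n}}"
      using f by (simp add: graph_aut_def pancake_verts Bij_def)
    moreover have "left_mult (sym_group n) (f id) \<in> extensional {g. g permutes {1..n}}"
      by (simp add: left_mult_def sym_group_def)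
    moreover have "f g = left_mult (sym_group n) (f id) g" if "g \<in> {g. g permutes {1..n}}" for g
      using f_eq_comp[of g] that by (simp add: left_mult_def sym_group_def)
    ultimately have "f = left_mult (sym_group n) (f id)"
      by (rule extensionalityI)
    then show "f \<in> left_regular (sym_group n)"
      using f_permutes[OF permutes_id] by (auto simp: left_regular_def sym_group_carrier)
  qed
  show "left_regular (sym_group n) \<subseteq> graph_aut (pancake_graph n)"
    by (auto simp: left_regular_def sym_group_carrier intro: left_mult_graph_aut)
qed

end
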